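(* Let $q$ be a prime power and let $\overline{\mathbb{F}_q}$ be an algebraic closure of the finite field $\mathbb{F}_q$. Let $A$ be an $\mathbb{F}_q$-subspace of $\overline{\mathbb{F}_q}$ of (finite) dimension $d$ over $\mathbb{F}_q$. Let $U$ be a two-dimensional $\mathbb{F}_q$-subspace of $\overline{\mathbb{F}_q}$, and suppose that $|A^{-1}\cap U|>d(q-1)$. Then $U^{-1}\subseteq A$, and there is a positive integer $e$ such that the $\mathbb{F}_q$-linear span of $U^{-1}$ is a one-dimensional $\mathbb{F}_{q^e}$-subspace of $\overline{\mathbb{F}_q}$.
   Context: For an $\mathbb{F}_q$-subspace $S$ of $\overline{\mathbb{F}_q}$, write $S^{-1}=\{x^{-1}: 0\neq x\in S\}$ for the set of inverses of the nonzero elements of $S$. For a positive integer $e$, $\mathbb{F}_{q^e}$ denotes the unique subfield of $\overline{\mathbb{F}_q}$ with $q^e$ elements; a one-dimensional $\mathbb{F}_{q^e}$-subspace of $\overline{\mathbb{F}_q}$ is a set of the form $\mathbb{F}_{q^e}\xi$ with $\xi\in\overline{\mathbb{F}_q}$, $\xi\ne 0$. *)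

theory Defs
  imports "HOL-Algebra.Algebraic_Closure" "HOL-Number_Theory.Prime_Powers"
begin

text \<open>
  For a subfield \<open>K\<close> of \<open>R\<close>, the library's \<^const>\<open>subalgebra\<close> only asks for closure under addition,
  negation and multiplication by elements of \<open>K\<close>, so \<open>subalgebra K V R\<close> says that \<open>V\<close> is a
  \<open>K\<close>-linear subspace of \<open>R\<close>.
\<close>

definition (in ring) inverses :: "'a set \<Rightarrow> 'a set"
  where "inverses S = (\<lambda>x. inv x) ` (S - {\<zero>})"

text \<open>
  The library's \<open>Span\<close> takes a list of generators; this is its analogue for an arbitrary set.
\<close>

definition (in ring) linear_span :: "'a set \<Rightarrow> 'a set \<Rightarrow> 'a set"
  where "linear_span K S = \<Inter> {V. subalgebra K V R \<and> S \<subseteq> V}"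

lemma (in ring) linear_span_set_eq_Span:
  assumes "subfield K R" and "set Us \<subseteq> carrier R"
  shows "linear_span K (set Us) = Span K Us"
  unfolding linear_span_def using Span_subalgebra_minimal[OF assms] by simp

end

theory Submission
  imports Defs
begin

text \<open>
  Choose \<open>v\<close> in \<open>A\<^sup>-\<^sup>1 \<inter> U\<close>, write \<open>U = Ku + Kv\<close>, \<open>x = u / v\<close>, and let \<open>n\<close> be the degree of \<open>x\<close> over
  \<open>K\<close>. Clearing denominators, a linear relation between \<open>v\<^sup>-\<^sup>1\<close> and the elements
  \<open>(u + av)\<^sup>-\<^sup>1 = v\<^sup>-\<^sup>1 / (x + a)\<close> becomes a polynomial equation for \<open>x\<close>, whence any \<open>n\<close> of these
  elements are linearly independent. The hypothesis provides more than \<open>d\<close> of them inside \<open>A\<close>, so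
  \<open>n \<le> d\<close>, and then \<open>n\<close> of them form a basis of \<open>K(x) v\<^sup>-\<^sup>1\<close>, which also contains \<open>U\<^sup>-\<^sup>1\<close>.
\<close>

section \<open>Cardinality of a finite-dimensional space over a finite field\<close>

text \<open>Adjoining a vector \<open>v\<close> outside \<open>E\<close> multiplies the cardinality
  by \<open>card K\<close>, because \<open>(k, e)\<close> can be recovered from the sum of
  \<open>k \<otimes> v\<close> and \<open>e\<close>.\<close>

lemma (in ring) card_of_dimension:
  assumes "subfield K R" "finite K" "dimension n K E"
  shows "finite E \<and> card E = card K ^ n"
  using assms(3,1,2)
proof (induction n K E rule: dimension.induct)
  case zero_dim
  then show ?case by simp
next
  case (Suc_dim v E n K)
  note K = \<open>subfield K R\<close>
  note E = space_subgroup_props[OF K Suc_dim.hyps(3)]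
  have sub: "K \<subseteq> carrier R"
    using subfieldE(3)[OF K] .
  define f where "f = (\<lambda>(k, e). k \<otimes> v \<oplus> e)"
  have img: "line_extension K v E = f ` (K \<times> E)"
    unfolding f_def by (force simp: line_extension_mem_iff)
  have "inj_on f (K \<times> E)"
  proof (rule inj_onI, clarsimp simp: f_def)
    fix k e k' e'
    assume k: "k \<in> K" "k' \<in> K" and e: "e \<in> E" "e' \<in> E"
      and eq: "k \<otimes> v \<oplus> e = k' \<otimes> v \<oplus> e'"
    have car: "k \<in> carrier R" "k' \<in> carrier R" "e \<in> carrier R" "e' \<in> carrier R"
      using k e sub E(1) by auto
    have "(k \<ominus> k') \<otimes> v = (k \<otimes> v \<oplus> e) \<ominus> k' \<otimes> v \<ominus> e"
      using car Suc_dim.hyps(1) by algebra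
    also have "\<dots> = e' \<ominus> e"
      unfolding eq using car Suc_dim.hyps(1) by algebra
    finally have diff: "(k \<ominus> k') \<otimes> v = e' \<ominus> e" .
    \<comment> \<open>Otherwise a nonzero multiple of \<open>v\<close> lies in \<open>E\<close>, and
      dividing by the scalar puts \<open>v\<close> itself into \<open>E\<close>.\<close>
    have "k \<ominus> k' = \<zero>"
    proof (rule ccontr)
      assume "k \<ominus> k' \<noteq> \<zero>"
      moreover have "k \<ominus> k' \<in> K"
        using k subringE(5,7)[OF subfieldE(1)[OF K]] unfolding a_minus_def by auto
      moreover have "(k \<ominus> k') \<otimes> v \<in> E"
        unfolding diff using e E(3,4) unfolding a_minus_def by auto
      ultimately show False
        using E(6)[of "k \<ominus> k'" v] Suc_dim.hyps(1,2) by simp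
    qed
    then have kk: "k = k'"
      using car by simp
    then show "k = k' \<and> e = e'"
      using eq car Suc_dim.hyps(1) by simp
  qed
  then show ?case
    using Suc_dim.IH Suc_dim.prems unfolding img by (simp add: card_image card_cartesian_product)
qed

section \<open>Lengths and degrees of polynomials over a subfield\<close>

text \<open>The minimal polynomial divides \<open>p\<close>, and a nonzero polynomial is one longer
  than its degree. This is the bound that every independence proof below contradicts.\<close>

lemma (in domain) degree_Irr_less_length:
  assumes "subfield K R" "x \<in> carrier R" "(algebraic over K) x"
    and "p \<in> carrier (K[X])" "p \<noteq> []" "eval p x = \<zero>"
  shows "degree (Irr K x) < length p"
proof -
  have "degree (Irr K x) \<le> degree p"
    using pdivides_imp_degree_le[OF subfieldE(1)[OF assms(1)] IrrE(1)[OF assms(1-3)] assms(4,5)]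
      Irr_minimal[OF assms(1-4,6)] by blast
  then show ?thesis
    using assms(5) by (cases p) auto
qed

text \<open>Lengths are tracked instead of degrees because they separate the zero polynomial
  \<open>[]\<close> from nonzero constants, which have the same \<open>degree\<close>.\<close>

lemma (in domain) univ_poly_mult_length:
  assumes "subfield K R" "p \<in> carrier (K[X])" "r \<in> carrier (K[X])"
  shows "length (p \<otimes>\<^bsub>K[X]\<^esub> r) = (if p = [] \<or> r = [] then 0 else length p + length r - 1)"
proof -
  interpret UP: domain "K[X]"
    using univ_poly_is_domain[OF subfieldE(1)[OF assms(1)]] .
  show ?thesis
  proof (cases "p = [] \<or> r = []")
    case True
    then show ?thesis
      using assms(2,3) UP.l_null UP.r_null by (auto simp: univ_poly_zero)
  next
    case False
    then have ne: "p \<otimes>\<^bsub>K[X]\<^esub> r \<noteq> []"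
      using UP.integral[OF _ assms(2,3)] by (auto simp: univ_poly_zero)
    have "degree (p \<otimes>\<^bsub>K[X]\<^esub> r) = degree p + degree r"
      using poly_mult_degree_eq[OF subfieldE(1)[OF assms(1)], of p r] assms(2,3) False
      unfolding univ_poly_mult sym[OF univ_poly_carrier] by argo
    moreover have "length p > 0" "length r > 0" "length (p \<otimes>\<^bsub>K[X]\<^esub> r) > 0"
      using False ne by auto
    ultimately have "length (p \<otimes>\<^bsub>K[X]\<^esub> r) = length p + length r - 1"
      by linarith
    then show ?thesis
      using False by simp
  qed
qed

section \<open>Products of linear factors\<close>

text \<open>Coefficients are listed from the leading one down, so \<open>[\<one>, a]\<close> is X +
  a. The product serves as common denominator of the fractions 1/(X + a).\<close>

definition (in ring) linear_prod :: "'a set \<Rightarrow> 'a list \<Rightarrow> 'a list"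
  where "linear_prod K as = foldr (\<lambda>a p. [\<one>, a] \<otimes>\<^bsub>K[X]\<^esub> p) as [\<one>]"

lemma (in domain) linear_poly_carrier:
  assumes "subfield K R" "a \<in> K"
  shows "[\<one>, a] \<in> carrier (K[X])"
  using subringE(3)[OF subfieldE(1)[OF assms(1)]] assms(2)
  unfolding sym[OF univ_poly_carrier] polynomial_def by auto

lemma (in domain) linear_prod_carrier:
  assumes "subfield K R" "set as \<subseteq> K"
  shows "linear_prod K as \<in> carrier (K[X]) \<and> length (linear_prod K as) = Suc (length as)"
  using assms(2)
proof (induction as)
  case Nil
  then show ?case
    using subringE(3)[OF subfieldE(1)[OF assms(1)]]
    unfolding sym[OF univ_poly_carrier] polynomial_def linear_prod_def by auto
next
  case (Cons a as)
  interpret UP: domain "K[X]"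
    using univ_poly_is_domain[OF subfieldE(1)[OF assms(1)]] .
  have l: "[\<one>, a] \<in> carrier (K[X])"
    using linear_poly_carrier assms(1) Cons.prems by simp
  have IH: "linear_prod K as \<in> carrier (K[X])" "length (linear_prod K as) = Suc (length as)"
    using Cons by auto
  have eq: "linear_prod K (a # as) = [\<one>, a] \<otimes>\<^bsub>K[X]\<^esub> linear_prod K as"
    by (simp add: linear_prod_def)
  have c: "linear_prod K (a # as) \<in> carrier (K[X])"
    unfolding eq using l IH(1) by blast
  have ne: "linear_prod K as \<noteq> []"
    using IH(2) by auto
  have "length (linear_prod K (a # as)) = Suc (length (a # as))"
    unfolding eq using univ_poly_mult_length[OF assms(1) l IH(1)] ne IH(2) by simp
  with c show ?case by blast
qed

lemma (in domain) eval_linear_prod: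
  assumes "subfield K R" "z \<in> carrier R"
  shows "eval (linear_prod K []) z = \<one>"
    and "set (a # as) \<subseteq> K \<Longrightarrow>
      eval (linear_prod K (a # as)) z = (z \<oplus> a) \<otimes> eval (linear_prod K as) z"
proof -
  show "eval (linear_prod K []) z = \<one>"
    using assms(2) by (simp add: linear_prod_def)
  assume as: "set (a # as) \<subseteq> K"
  interpret ev: ring_hom_ring "K[X]" R "\<lambda>p. eval p z"
    using eval_ring_hom[OF subfieldE(1)[OF assms(1)] assms(2)] .
  have a: "a \<in> carrier R"
    using as subfieldE(3)[OF assms(1)] by auto
  have "eval [\<one>, a] z = z \<oplus> a"
    using a assms(2) by simp
  then show "eval (linear_prod K (a # as)) z = (z \<oplus> a) \<otimes> eval (linear_prod K as) z"
    using ev.hom_mult[OF linear_poly_carrier[OF assms(1), of a]] linear_prod_carrier[OF assms(1), of as] as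
    by (simp add: linear_prod_def del: eval.simps)
qed

lemma (in domain) eval_linear_prod_carrier:
  assumes "subfield K R" "z \<in> carrier R" "set as \<subseteq> K"
  shows "eval (linear_prod K as) z \<in> carrier R"
  using linear_prod_carrier[OF assms(1,3)] eval_poly_in_carrier[OF subfieldE(1)[OF assms(1)] _ assms(2)]
  by (simp add: univ_poly_carrier)

lemma (in domain) eval_linear_prod_nonzero:
  assumes "subfield K R" "z \<in> carrier R" "set as \<subseteq> K" "\<And>a. a \<in> set as \<Longrightarrow> z \<oplus> a \<noteq> \<zero>"
  shows "eval (linear_prod K as) z \<noteq> \<zero>"
  using assms(3,4)
proof (induction as)
  case Nil
  then show ?case
    using eval_linear_prod(1)[OF assms(1,2)] by simp
next
  case (Cons a as)
  then have "a \<in> carrier R" "set as \<subseteq> K"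
    using subfieldE(3)[OF assms(1)] by auto
  with Cons show ?case
    using eval_linear_prod(2)[OF assms(1,2) Cons.prems(1)]
      eval_linear_prod_carrier[OF assms(1,2), of as] assms(2) integral_iff by auto
qed

section \<open>Linear independence of inverses of shifts of an algebraic element\<close>

text \<open>Clearing denominators: multiplying a sum of terms k_a w/(x + a) by the product of all x
  + a cancels one factor in each term. What remains is a polynomial in x of degree below the number
  of factors, times w.\<close>

lemma (in field) Span_inverses_linear:
  assumes K: "subfield K R" and x: "x \<in> carrier R" and w: "w \<in> carrier R"
    and "set as \<subseteq> K" "\<And>a. a \<in> set as \<Longrightarrow> x \<oplus> a \<noteq> \<zero>"
    and "y \<in> Span K (map (\<lambda>a. inv (x \<oplus> a) \<otimes> w) as)"
  shows "\<exists>g \<in> carrier (K[X]). length g \<le> length as \<and>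
    eval (linear_prod K as) x \<otimes> y = eval g x \<otimes> w"
  using assms(4-6)
proof (induction as arbitrary: y)
  case Nil
  then show ?case
    using w eval_linear_prod_carrier[OF K x, of "[]"]
    by (intro bexI[of _ "[]"]) (auto simp: sym[OF univ_poly_carrier] polynomial_def)
next
  case (Cons a as)
  interpret UP: domain "K[X]"
    using univ_poly_is_domain[OF subfieldE(1)[OF K]] .
  interpret ev: ring_hom_ring "K[X]" R "\<lambda>p. eval p x"
    using eval_ring_hom[OF subfieldE(1)[OF K] x] .
  have sub: "K \<subseteq> carrier R"
    using subfieldE(3)[OF K] .
  have as: "set as \<subseteq> K" and a: "a \<in> K" "a \<in> carrier R" "x \<oplus> a \<noteq> \<zero>"
    using Cons.prems sub by auto
  have i: "inv (x \<oplus> a) \<in> carrier R" "(x \<oplus> a) \<otimes> inv (x \<oplus> a) = \<one>"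
    using a x field_Units by auto
  obtain k y' where k: "k \<in> K" and y': "y' \<in> Span K (map (\<lambda>a. inv (x \<oplus> a) \<otimes> w) as)"
    and y: "y = k \<otimes> (inv (x \<oplus> a) \<otimes> w) \<oplus> y'"
    using Cons.prems(3) by (auto simp: line_extension_mem_iff)
  obtain g where g: "g \<in> carrier (K[X])" "length g \<le> length as"
    and gy: "eval (linear_prod K as) x \<otimes> y' = eval g x \<otimes> w"
    using Cons.IH[OF as _ y'] Cons.prems(2) by auto
  have "inv (x \<oplus> b) \<in> carrier R" if "b \<in> set as" for b
    using that Cons.prems(2)[of b] x as sub by (auto simp: field_Units)
  then have y'c: "y' \<in> carrier R"
    using Span_in_carrier[OF sub, of "map (\<lambda>a. inv (x \<oplus> a) \<otimes> w) as"] y' w by auto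
  \<comment> \<open>The normalized constant is \<open>[]\<close> when \<open>k\<close> is zero,
    hence only a bound on its length.\<close>
  define c where "c = poly_of_const k"
  have kc: "k \<in> carrier R"
    using k sub by auto
  have c: "c \<in> carrier (K[X])" "length c \<le> 1" "eval c x = k"
    using k kc normalize_gives_polynomial[of "[k]" K] normalize_length_le[of "[k]"]
      eval_normalize[of "[k]" x] x
    unfolding c_def poly_of_const_def by (auto simp: univ_poly_carrier)
  have P: "linear_prod K as \<in> carrier (K[X])" "length (linear_prod K as) = Suc (length as)"
    using linear_prod_carrier[OF K as] by auto
  have l: "[\<one>, a] \<in> carrier (K[X])"
    using linear_poly_carrier[OF K a(1)] .
  \<comment> \<open>Multiplying y = k w/(x + a) + y' by (x + a) P(x), with P the product over
    \<open>as\<close>, gives (k P(x) + (x + a) g(x)) w.\<close>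
  define h where "h = c \<otimes>\<^bsub>K[X]\<^esub> linear_prod K as \<oplus>\<^bsub>K[X]\<^esub> [\<one>, a] \<otimes>\<^bsub>K[X]\<^esub> g"
  have hc: "h \<in> carrier (K[X])"
    unfolding h_def using c P l g by blast
  have "length h \<le> max (length (c \<otimes>\<^bsub>K[X]\<^esub> linear_prod K as)) (length ([\<one>, a] \<otimes>\<^bsub>K[X]\<^esub> g))"
    unfolding h_def univ_poly_add by (rule poly_add_length_le)
  then have hl: "length h \<le> length (a # as)"
    using univ_poly_mult_length[OF K c(1) P(1)] univ_poly_mult_length[OF K l g(1)] P(2) g(2) c(2)
    by (auto split: if_splits)
  define e where "e = eval (linear_prod K as) x"
  have ec: "e \<in> carrier R" "eval g x \<in> carrier R"
    using P(1) g(1) unfolding e_def by auto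
  have "eval [\<one>, a] x = x \<oplus> a"
    using a x by simp
  then have "eval h x = k \<otimes> e \<oplus> (x \<oplus> a) \<otimes> eval g x"
    unfolding h_def e_def using c P(1) l g(1) by (simp del: eval.simps)
  moreover have "((x \<oplus> a) \<otimes> e) \<otimes> y = (k \<otimes> e \<oplus> (x \<oplus> a) \<otimes> eval g x) \<otimes> w"
  proof -
    define j where "j = inv (x \<oplus> a)"
    have j: "j \<in> carrier R" "(x \<oplus> a) \<otimes> j = \<one>"
      using i unfolding j_def by auto
    \<comment> \<open>The product of \<open>x \<oplus> a\<close> and \<open>j\<close> is kept
      together, since \<open>algebra\<close> sees \<open>j\<close> only as an arbitrary ring
      element.\<close>
    have "((x \<oplus> a) \<otimes> e) \<otimes> y = k \<otimes> e \<otimes> w \<otimes> ((x \<oplus> a) \<otimes> j) \<oplus> (x \<oplus> a) \<otimes> (e \<otimes> y')"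
      unfolding y j_def[symmetric] using j(1) ec(1) y'c kc w x a(2) by algebra
    also have "\<dots> = k \<otimes> e \<otimes> w \<oplus> (x \<oplus> a) \<otimes> (eval g x \<otimes> w)"
      using gy ec kc w unfolding j(2) e_def by simp
    also have "\<dots> = (k \<otimes> e \<oplus> (x \<oplus> a) \<otimes> eval g x) \<otimes> w"
      using ec kc w x a(2) by algebra
    finally show ?thesis .
  qed
  ultimately show ?case
    using hc hl eval_linear_prod(2)[OF K x Cons.prems(1)] unfolding e_def
    by (intro bexI[of _ h]) auto
qed

text \<open>If w/(x + a) depended on the later vectors, clearing denominators would give a nonzero
  polynomial vanishing at x with too few coefficients for the degree of x.\<close>

lemma (in field) independent_inverses_linear:
  assumes K: "subfield K R" and x: "x \<in> carrier R" and alg: "(algebraic over K) x"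
    and w: "w \<in> carrier R" "w \<noteq> \<zero>"
    and "distinct as" "set as \<subseteq> K" "\<And>a. a \<in> set as \<Longrightarrow> x \<oplus> a \<noteq> \<zero>"
    and "length as \<le> degree (Irr K x)"
  shows "independent K (map (\<lambda>a. inv (x \<oplus> a) \<otimes> w) as)"
  using assms(6-9)
proof (induction as)
  case Nil
  then show ?case by simp
next
  case (Cons a as)
  interpret UP: domain "K[X]"
    using univ_poly_is_domain[OF subfieldE(1)[OF K]] .
  have sub: "K \<subseteq> carrier R"
    using subfieldE(3)[OF K] .
  have as: "set as \<subseteq> K" and a: "a \<in> K" "a \<in> carrier R" "x \<oplus> a \<noteq> \<zero>"
    using Cons.prems sub by auto
  define j where "j = inv (x \<oplus> a)"
  have j: "j \<in> carrier R" "(x \<oplus> a) \<otimes> j = \<one>"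
    using a x field_Units unfolding j_def by auto
  have P: "linear_prod K as \<in> carrier (K[X])" "length (linear_prod K as) = Suc (length as)"
    using linear_prod_carrier[OF K as] by auto
  have l: "[\<one>, a] \<in> carrier (K[X])"
    using linear_poly_carrier[OF K a(1)] .
  have evl: "eval [\<one>, a] z = z \<oplus> a" if "z \<in> carrier R" for z
    using a that by simp
  have "j \<otimes> w \<notin> Span K (map (\<lambda>a. inv (x \<oplus> a) \<otimes> w) as)"
  proof
    assume "j \<otimes> w \<in> Span K (map (\<lambda>a. inv (x \<oplus> a) \<otimes> w) as)"
    then obtain g where g: "g \<in> carrier (K[X])" "length g \<le> length as"
      and gw: "eval (linear_prod K as) x \<otimes> (j \<otimes> w) = eval g x \<otimes> w"
      using Span_inverses_linear[OF K x w(1) as] Cons.prems(3) by auto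
    \<comment> \<open>This is the relation multiplied by all denominators, including X + a.\<close>
    define p where "p = linear_prod K as \<ominus>\<^bsub>K[X]\<^esub> [\<one>, a] \<otimes>\<^bsub>K[X]\<^esub> g"
    have pc: "p \<in> carrier (K[X])"
      unfolding p_def using P(1) l g(1) by blast
    \<comment> \<open>Two points matter: x, where \<open>p\<close> vanishes, and -a, where it does
      not.\<close>
    have evp: "eval p z = eval (linear_prod K as) z \<ominus> (z \<oplus> a) \<otimes> eval g z"
      if z: "z \<in> carrier R" for z
    proof -
      interpret ev: ring_hom_ring "K[X]" R "\<lambda>p. eval p z"
        using eval_ring_hom[OF subfieldE(1)[OF K] z] .
      show ?thesis
        unfolding p_def a_minus_def using P(1) l g(1) evl[OF z] by (simp del: eval.simps)
    qed
    have gz: "eval g z \<in> carrier R" if "z \<in> carrier R" for z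
      using eval_poly_in_carrier[OF subfieldE(1)[OF K] _ that] g(1) by (simp add: univ_poly_carrier)
    note Pz = eval_linear_prod_carrier[OF K _ as]
    have "(eval (linear_prod K as) x \<otimes> j) \<otimes> w = eval g x \<otimes> w"
      using gw j(1) w(1) Pz[OF x] by (simp add: m_assoc)
    then have "eval (linear_prod K as) x \<otimes> j = eval g x"
      using m_rcancel[OF w(2,1) m_closed[OF Pz[OF x] j(1)] gz[OF x]] by simp
    then have "(x \<oplus> a) \<otimes> eval g x = eval (linear_prod K as) x \<otimes> ((x \<oplus> a) \<otimes> j)"
      using m_lcomm[of "x \<oplus> a" "eval (linear_prod K as) x" j] j(1) Pz[OF x] x a(2) by simp
    then have "(x \<oplus> a) \<otimes> eval g x = eval (linear_prod K as) x"
      unfolding j(2) using Pz[OF x] by simp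
    then have root: "eval p x = \<zero>"
      unfolding evp[OF x] using Pz[OF x] by simp
    \<comment> \<open>At -a the term (X + a) g drops out, and the other factors become b - a,
      nonzero because the list is distinct.\<close>
    have "eval (linear_prod K as) (\<ominus> a) \<noteq> \<zero>"
    proof (rule eval_linear_prod_nonzero[OF K _ as])
      fix b assume b: "b \<in> set as"
      then have "b \<noteq> a" "b \<in> carrier R"
        using Cons.prems(1) as sub by auto
      then show "\<ominus> a \<oplus> b \<noteq> \<zero>"
        using a(2) minus_equality[of b "\<ominus> a"] by (auto simp: a_comm)
    qed (use a in simp)
    then have "eval p (\<ominus> a) \<noteq> \<zero>"
      unfolding evp[OF a_inv_closed[OF a(2)]] using a(2) gz[of "\<ominus> a"] Pz[of "\<ominus> a"]
      by (simp add: l_neg a_minus_def)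
    then have "p \<noteq> []"
      by auto
    then have "degree (Irr K x) < length p"
      using degree_Irr_less_length[OF K x alg pc _ root] by blast
    \<comment> \<open>Both terms have length at most \<open>Suc (length as)\<close>, which is the
      length of \<open>a # as\<close> and so at most the degree of x.\<close>
    moreover have "length p \<le> max (length (linear_prod K as)) (length ([\<one>, a] \<otimes>\<^bsub>K[X]\<^esub> g))"
      unfolding p_def a_minus_def univ_poly_add
      using poly_add_length_le[of "linear_prod K as"]
        univ_poly_a_inv_length[OF subfieldE(1)[OF K] UP.m_closed[OF l g(1)]]
      by metis
    ultimately show False
      using Cons.prems(4) P(2) g(2) univ_poly_mult_length[OF K l g(1)] by (auto split: if_splits)
  qed
  moreover have "independent K (map (\<lambda>a. inv (x \<oplus> a) \<otimes> w) as)"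
    using Cons by auto
  ultimately show ?case
    using j(1) w(1) unfolding j_def by (auto intro: li_Cons)
qed

text \<open>With \<open>w\<close> added there are still at most as many vectors as the degree of x,
  hence the strict bound on \<open>length as\<close>. A relation for \<open>w\<close> gives P(x) =
  g(x) with g shorter than the product P, so P - g is nonzero but too short to vanish at x.\<close>

lemma (in field) independent_Cons_inverses_linear:
  assumes K: "subfield K R" and x: "x \<in> carrier R" and alg: "(algebraic over K) x"
    and w: "w \<in> carrier R" "w \<noteq> \<zero>"
    and as: "distinct as" "set as \<subseteq> K" "\<And>a. a \<in> set as \<Longrightarrow> x \<oplus> a \<noteq> \<zero>"
    and len: "length as < degree (Irr K x)"
  shows "independent K (w # map (\<lambda>a. inv (x \<oplus> a) \<otimes> w) as)"
proof (rule li_Cons)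
  interpret UP: domain "K[X]"
    using univ_poly_is_domain[OF subfieldE(1)[OF K]] .
  interpret ev: ring_hom_ring "K[X]" R "\<lambda>p. eval p x"
    using eval_ring_hom[OF subfieldE(1)[OF K] x] .
  have P: "linear_prod K as \<in> carrier (K[X])" "length (linear_prod K as) = Suc (length as)"
    using linear_prod_carrier[OF K as(2)] by auto
  show "w \<notin> Span K (map (\<lambda>a. inv (x \<oplus> a) \<otimes> w) as)"
  proof
    assume "w \<in> Span K (map (\<lambda>a. inv (x \<oplus> a) \<otimes> w) as)"
    then obtain g where g: "g \<in> carrier (K[X])" "length g \<le> length as"
      and gw: "eval (linear_prod K as) x \<otimes> w = eval g x \<otimes> w"
      using Span_inverses_linear[OF K x w(1) as(2,3)] by auto
    define p where "p = linear_prod K as \<ominus>\<^bsub>K[X]\<^esub> g"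
    have pc: "p \<in> carrier (K[X])"
      unfolding p_def using P(1) g(1) by blast
    have "eval (linear_prod K as) x = eval g x"
      using gw m_rcancel[OF w(2,1)] P(1) g(1) by simp
    then have root: "eval p x = \<zero>"
      unfolding p_def a_minus_def using P(1) g(1) by (simp add: r_neg)
    have "linear_prod K as \<noteq> g"
      using P(2) g(2) by auto
    then have "p \<noteq> []"
      unfolding p_def using UP.r_right_minus_eq[OF P(1) g(1)] by (simp add: univ_poly_zero)
    then have "degree (Irr K x) < length p"
      using degree_Irr_less_length[OF K x alg pc _ root] by blast
    moreover have "length p \<le> max (length (linear_prod K as)) (length g)"
      unfolding p_def a_minus_def univ_poly_add
      using poly_add_length_le univ_poly_a_inv_length[OF subfieldE(1)[OF K]] g(1) by metis
    ultimately show False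
      using len P(2) g(2) by auto
  qed
  show "independent K (map (\<lambda>a. inv (x \<oplus> a) \<otimes> w) as)"
    using independent_inverses_linear[OF K x alg w as] len by simp
qed (rule w(1))

section \<open>Multiples of a subring and sets of inverses\<close>

text \<open>The coset is multiplicative, so it is the set of all products e w; distributivity and
  associativity carry the K-linear structure over from \<open>E\<close>.\<close>

lemma (in ring) r_coset_is_subalgebra:
  assumes "subring E R" "K \<subseteq> E" "w \<in> carrier R"
  shows "subalgebra K (E #> w) R"
proof -
  note E = subringE[OF assms(1)]
  have mem: "y \<in> E #> w \<longleftrightarrow> (\<exists>e\<in>E. y = e \<otimes> w)" for y
    unfolding r_coset_def by auto
  have "subgroup (E #> w) (add_monoid R)"
  proof (rule add.subgroupI)
    show "E #> w \<subseteq> carrier R" "E #> w \<noteq> {}"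
      using E(1,2) assms(3) mem by force+
  next
    fix y assume "y \<in> E #> w"
    then obtain e where e: "e \<in> E" "y = e \<otimes> w"
      using mem by auto
    then have "\<ominus> y = (\<ominus> e) \<otimes> w"
      using E(1) assms(3) by (auto simp: l_minus)
    then show "\<ominus> y \<in> E #> w"
      using mem E(5)[OF e(1)] by auto
  next
    fix y z assume "y \<in> E #> w" "z \<in> E #> w"
    then obtain e f where ef: "e \<in> E" "y = e \<otimes> w" "f \<in> E" "z = f \<otimes> w"
      using mem by auto
    then have "y \<oplus> z = (e \<oplus> f) \<otimes> w"
      using subsetD[OF E(1)] assms(3) l_distr[of e f w] by auto
    then show "y \<oplus> z \<in> E #> w"
      using mem E(7)[OF ef(1,3)] by auto
  qed
  moreover have "k \<otimes> y \<in> E #> w" if "k \<in> K" "y \<in> E #> w" for k y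
  proof -
    obtain e where e: "e \<in> E" "y = e \<otimes> w"
      using mem \<open>y \<in> E #> w\<close> by auto
    have "k \<in> E"
      using assms(2) that by auto
    then have "k \<otimes> y = (k \<otimes> e) \<otimes> w"
      using subsetD[OF E(1)] e assms(3) m_assoc[of k e w] by auto
    then show ?thesis
      using mem E(6)[OF \<open>k \<in> E\<close> e(1)] by auto
  qed
  ultimately show ?thesis
    unfolding subalgebra_def subalgebra_axioms_def by blast
qed

lemma (in field) mem_inverses_iff:
  assumes "S \<subseteq> carrier R"
  shows "t \<in> inverses S \<longleftrightarrow> t \<in> carrier R \<and> t \<noteq> \<zero> \<and> inv t \<in> S"
proof
  assume "t \<in> inverses S"
  then obtain s where s: "s \<in> S" "s \<noteq> \<zero>" "t = inv s"
    unfolding inverses_def by auto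
  then have "s \<in> Units R"
    using assms field_Units by auto
  then show "t \<in> carrier R \<and> t \<noteq> \<zero> \<and> inv t \<in> S"
    using s Units_inv_Units[of s] field_Units by auto
next
  assume t: "t \<in> carrier R \<and> t \<noteq> \<zero> \<and> inv t \<in> S"
  then have u: "t \<in> Units R"
    using field_Units by auto
  then have "inv t \<noteq> \<zero>"
    using Units_inv_Units[of t] field_Units by auto
  then show "t \<in> inverses S"
    unfolding inverses_def using t Units_inv_inv[OF u] by (intro image_eqI[of _ _ "inv t"]) auto
qed

lemma (in field) inv_mult:
  assumes "a \<in> carrier R" "a \<noteq> \<zero>" "b \<in> carrier R" "b \<noteq> \<zero>"
  shows "inv (a \<otimes> b) = inv a \<otimes> inv b"
proof -
  have ab: "a \<in> Units R" "b \<in> Units R"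
    using assms field_Units by auto
  have "(inv a \<otimes> inv b) \<otimes> (a \<otimes> b) = (inv a \<otimes> a) \<otimes> (inv b \<otimes> b)"
    using assms ab by (simp add: m_ac del: Units_l_inv Units_r_inv)
  then have "(inv a \<otimes> inv b) \<otimes> (a \<otimes> b) = \<one>"
    using ab by simp
  then show ?thesis
    using inv_unique'[of "a \<otimes> b" "inv a \<otimes> inv b"] ab assms by (metis Units_inv_closed Units_m_closed
        m_closed m_comm)
qed

section \<open>Counting in a plane line by line\<close>

text \<open>Each nonzero vector c u + b v lies on the line of v or on that of some u + a v. As
  \<open>T\<close> is stable under nonzero scalars, a line of the second kind that meets
  \<open>T\<close> has its generator in \<open>T\<close>. The \<open>Suc\<close> accounts for the
  line of v.\<close>

lemma (in field) card_le_of_plane: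
  assumes K: "subfield K R" "finite K" and uv: "u \<in> carrier R" "v \<in> carrier R"
    and T: "\<And>t. t \<in> T \<Longrightarrow> t \<noteq> \<zero> \<and> (\<exists>c\<in>K. \<exists>b\<in>K. t = c \<otimes> u \<oplus> b \<otimes> v)"
    and smult: "\<And>c t. c \<in> K - {\<zero>} \<Longrightarrow> t \<in> T \<Longrightarrow> c \<otimes> t \<in> T"
  shows "card T \<le> (card K - 1) * Suc (card {a \<in> K. u \<oplus> a \<otimes> v \<in> T})"
proof -
  have sub: "K \<subseteq> carrier R"
    using subfieldE(3)[OF K(1)] .
  note Kc = subringE[OF subfieldE(1)[OF K(1)]]
  define I where "I = {a \<in> K. u \<oplus> a \<otimes> v \<in> T}"
  define N where "N = (\<lambda>c. c \<otimes> v) ` (K - {\<zero>}) \<union>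
    (\<lambda>(c, a). c \<otimes> (u \<oplus> a \<otimes> v)) ` ((K - {\<zero>}) \<times> I)"
  have fin: "finite I"
    using K(2) unfolding I_def by auto
  have "T \<subseteq> N"
  proof
    fix t assume t: "t \<in> T"
    then obtain c b where cb: "c \<in> K" "b \<in> K" "t = c \<otimes> u \<oplus> b \<otimes> v" "t \<noteq> \<zero>"
      using T by blast
    then have car: "c \<in> carrier R" "b \<in> carrier R"
      using sub by auto
    show "t \<in> N"
    proof (cases "c = \<zero>")
      case True
      then have "t = b \<otimes> v" "b \<noteq> \<zero>"
        using cb uv car by auto
      then show ?thesis
        unfolding N_def using cb(2) by auto
    next
      case False
      then have ic: "inv c \<in> K - {\<zero>}" "inv c \<otimes> c = \<one>" "c \<otimes> inv c = \<one>"
        using subfield_m_inv[OF K(1), of c] cb(1) by auto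
      then have icc: "inv c \<in> carrier R"
        using sub by auto
      \<comment> \<open>Scaling the coefficient of u to 1 turns that of v into this slope.\<close>
      define a where "a = inv c \<otimes> b"
      have a: "a \<in> K" "a \<in> carrier R"
        unfolding a_def using Kc(6) ic(1) cb(2) sub by auto
      have "inv c \<otimes> t = (inv c \<otimes> c) \<otimes> u \<oplus> a \<otimes> v"
        unfolding a_def cb(3) using icc car uv by (simp add: r_distr m_assoc)
      then have ict: "inv c \<otimes> t = u \<oplus> a \<otimes> v"
        using ic(2) uv by simp
      then have "a \<in> I"
        unfolding I_def using smult[OF ic(1) t] a(1) by auto
      moreover have "c \<otimes> (u \<oplus> a \<otimes> v) = (c \<otimes> inv c) \<otimes> t"
        unfolding ict[symmetric] using icc car uv cb(3) by (simp add: m_assoc)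
      then have "t = c \<otimes> (u \<oplus> a \<otimes> v)"
        using ic(3) car uv cb(3) by simp
      ultimately show ?thesis
        unfolding N_def using cb(1) False by auto
    qed
  qed
  moreover have "finite N"
    unfolding N_def using K(2) fin by auto
  moreover have "card N \<le> card (K - {\<zero>}) + card ((K - {\<zero>}) \<times> I)"
    unfolding N_def using K(2) fin
    by (intro order.trans[OF card_Un_le] add_mono card_image_le) auto
  moreover have "card (K - {\<zero>}) = card K - 1"
    using Kc(2) K(2) by simp
  ultimately show ?thesis
    unfolding I_def[symmetric] by (metis card_mono card_cartesian_product mult_Suc_right order.trans)
qed

section \<open>Planes containing many inverses of elements of a subspace\<close>

theorem theorem1:
  fixes L (structure) and K A U :: "'a set" and q d :: nat
  assumes "primepow q"
    and "algebraic_closure L K" and "card K = q"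
    and "subalgebra K A L" and "ring.dimension L d K A"
    and "subalgebra K U L" and "ring.dimension L 2 K U"
    and "card (ring.inverses L A \<inter> U) > d * (q - 1)"
  shows "ring.inverses L U \<subseteq> A \<and>
    (\<exists>e>0. \<exists>E. subfield E L \<and> card E = q ^ e \<and>
      (\<exists>\<xi> \<in> carrier L - {\<zero>}. ring.linear_span L K (ring.inverses L U) = E #> \<xi>))"
proof -
  interpret algebraic_closure L K
    by (rule assms(2))
  have K: "subfield K L"
    by (rule subfield_axioms)
  note sub = subfieldE(3)[OF K]
  note Kc = subringE[OF subfieldE(1)[OF K]]
  have "q > 0"
    using assms(1) primepow_gt_0_nat by blast
  then have finK: "finite K"
    using assms(3) card_gt_0_iff by blast
  have Ac: "A \<subseteq> carrier L" and Uc: "U \<subseteq> carrier L"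
    using subalgebra_in_carrier assms(4,6) by auto
  define T where "T = inverses A \<inter> U"
  have T: "t \<in> T \<longleftrightarrow> t \<in> U \<and> t \<in> carrier L \<and> t \<noteq> \<zero> \<and> inv t \<in> A" for t
    unfolding T_def using mem_inverses_iff[OF Ac] by blast
  have smult: "c \<otimes> t \<in> T" if c: "c \<in> K - {\<zero>}" and t: "t \<in> T" for c t
  proof -
    have cc: "c \<in> carrier L" "c \<noteq> \<zero>" "inv c \<in> K"
      using c sub subfield_m_inv(1)[OF K c] by auto
    have "inv (c \<otimes> t) = inv c \<otimes> inv t"
      using inv_mult cc t T by simp
    then show ?thesis
      unfolding T using t[unfolded T] cc c subalgebra.smult_closed[OF assms(4) cc(3)]
        subalgebra.smult_closed[OF assms(6)] integral_iff by auto
  qed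
  have "card T > 0"
    using assms(8) unfolding T_def by simp
  \<comment> \<open>Taking v in A^-1 puts \<open>inv v\<close> into \<open>A\<close>; this supplies
    the extra vector in the proof of n \<le> d.\<close>
  then obtain v where v: "v \<in> T"
    by (metis card.empty all_not_in_conv less_irrefl)
  then have v': "v \<in> U" "v \<in> carrier L" "v \<noteq> \<zero>" "inv v \<in> A"
    using T by auto
  have "independent K [v]"
    using v' by (auto intro: li_Cons)
  then obtain Vs where Vs: "length (Vs @ [v]) = 2" "independent K (Vs @ [v])" "Span K (Vs @ [v]) = U"
    \<comment> \<open>The completion prepends vectors, so v stays last in the basis.\<close>
    using complete_base[OF K assms(7), of "[v]"] v'(1) by auto
  then obtain u where "Vs = [u]"
    by (cases Vs) auto
  with Vs have ind: "independent K [u, v]" and sp: "Span K [u, v] = U"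
    by auto
  have u: "u \<in> carrier L" "u \<notin> Span K [v]"
    using independent_backwards[OF ind] by auto
  have Kv: "line_extension K v {\<zero>} = (\<lambda>b. b \<otimes> v) ` K"
    using v'(2) subsetD[OF sub] by (force simp: line_extension_mem_iff)
  have memU: "t \<in> U \<longleftrightarrow> (\<exists>c\<in>K. \<exists>b\<in>K. t = c \<otimes> u \<oplus> b \<otimes> v)" for t
    using line_extension_mem_iff[of t K u "line_extension K v {\<zero>}"] Kv
    unfolding sp[symmetric] by auto
  define w where "w = inv v"
  have vU: "v \<in> Units L"
    using v' field_Units by auto
  have w: "w \<in> carrier L" "w \<noteq> \<zero>" "w \<otimes> v = \<one>" "w \<in> A"
    unfolding w_def using vU v' Units_inv_Units[OF vU] field_Units by auto
  \<comment> \<open>Dividing by v turns U into Kx + K, which lies in the field K(x).\<close>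
  define x where "x = u \<otimes> w"
  have x: "x \<in> carrier L"
    unfolding x_def using u w by simp
  have xv: "x \<otimes> v = u"
    unfolding x_def using u w v' by (simp add: m_assoc)
  have shift: "(c \<otimes> x \<oplus> b) \<otimes> v = c \<otimes> u \<oplus> b \<otimes> v" if "c \<in> carrier L" "b \<in> carrier L" for b c
    using that x v' xv by (simp add: l_distr m_assoc)
  have nz: "x \<oplus> a \<noteq> \<zero>" if a: "a \<in> K" for a
  proof
    assume "x \<oplus> a = \<zero>"
    moreover have ac: "a \<in> carrier L"
      using a sub by auto
    ultimately have "x = \<ominus> a"
      using minus_equality[of x a] x by simp
    then have "u = (\<ominus> a) \<otimes> v"
      using xv by simp
    then have "u \<in> Span K [v]"
      using Kc(5)[OF a] Kv by auto
    then show False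
      using u by blast
  qed
  have alg: "(algebraic over K) x"
    using algebraic_extension[OF x] .
  \<comment> \<open>This is the exponent e of the conclusion, and \<open>E\<close> below is the
    field with q^e elements.\<close>
  define n where "n = degree (Irr K x)"
  define E where "E = simple_extension K x"
  have E: "subfield E L"
    unfolding E_def using simple_extension_is_subfield[OF K x] alg by blast
  note Ec = subringE[OF subfieldE(1)[OF E]]
  have KE: "K \<subseteq> E" and xE: "x \<in> E"
    unfolding E_def using simple_extension_incl[OF sub x]
      simple_extension_mem[OF subfieldE(1)[OF K] x] by auto
  have dimE: "dimension n K E"
    unfolding E_def n_def using dimension_simple_extension[OF K x alg] .
  then have cardE: "finite E" "card E = q ^ n"
    using card_of_dimension[OF K finK] assms(3) by auto
  have n0: "n > 0"
    using dimE dimension_zero[OF K, of E] Ec(3) by (cases n) auto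

  define I where "I = {a \<in> K. u \<oplus> a \<otimes> v \<in> T}"
  have "card T \<le> (q - 1) * Suc (card I)"
    unfolding I_def assms(3)[symmetric]
    using card_le_of_plane[OF K finK u(1) v'(2), of T] smult T memU by blast
  then have "d * (q - 1) < Suc (card I) * (q - 1)"
    using assms(8) unfolding T_def[symmetric] by (simp add: mult.commute)
  \<comment> \<open>Cancelling q - 1 leaves d < card I + 1, where the 1 comes from the line of
    v.\<close>
  then have "d \<le> card I"
    unfolding mult_less_cancel2 by simp
  then obtain J where J: "J \<subseteq> I" "card J = d" "finite J"
    using obtain_subset_with_card_n by metis
  then obtain as where as: "set as = J" "distinct as" "length as = d"
    using finite_distinct_list[of J] distinct_card by metis
  have asK: "set as \<subseteq> K"
    using as J I_def by auto
  \<comment> \<open>\<open>F a\<close> is the inverse of u + a v, written so that the independence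
    lemmas apply.\<close>
  define F where "F = (\<lambda>a. inv (x \<oplus> a) \<otimes> w)"
  have F: "F a \<in> inverses U \<inter> A" if a: "a \<in> set as" for a
  proof -
    have ac: "a \<in> carrier L" "u \<oplus> a \<otimes> v \<in> T" "x \<oplus> a \<noteq> \<zero>"
      using a as J I_def sub nz by auto
    have "(x \<oplus> a) \<otimes> v = u \<oplus> a \<otimes> v"
      using shift[of \<one> a] ac x u by simp
    then have "F a = inv (u \<oplus> a \<otimes> v)"
      unfolding F_def w_def using inv_mult[of "x \<oplus> a" v] ac x v' by simp
    then show ?thesis
      using ac(2) T unfolding inverses_def by auto
  qed
  \<comment> \<open>Otherwise \<open>w\<close> and the d elements \<open>F a\<close> would be d + 1
    independent vectors in the d-dimensional space \<open>A\<close>.\<close>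
  have "n \<le> d"
  proof (rule ccontr)
    assume "\<not> n \<le> d"
    then have "independent K (w # map F as)"
      unfolding F_def
      using independent_Cons_inverses_linear[OF K x alg w(1,2) as(2) asK] nz asK as(3) n_def by auto
    moreover have "set (w # map F as) \<subseteq> A"
      using F w by auto
    ultimately have "length (w # map F as) \<le> d"
      using independent_length_le_dimension[OF K assms(5)] by blast
    then show False
      using as(3) by simp
  qed
  define Fs where "Fs = map F (take n as)"
  have tk: "set (take n as) \<subseteq> set as"
    by (rule set_take_subset)
  have len: "length Fs = n"
    unfolding Fs_def using as(3) \<open>n \<le> d\<close> by simp
  have indF: "independent K Fs"
    unfolding Fs_def F_def
  proof (rule independent_inverses_linear[OF K x alg w(1,2)])
    show "x \<oplus> a \<noteq> \<zero>" if "a \<in> set (take n as)" for a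
      using nz that tk asK by blast
  qed (use as(2) asK tk n_def in auto)
  have FsU: "set Fs \<subseteq> inverses U \<inter> A"
    unfolding Fs_def using F tk by auto
  have memE: "y \<in> E #> w \<longleftrightarrow> (\<exists>e\<in>E. y = e \<otimes> w)" for y
    unfolding r_coset_def by auto
  \<comment> \<open>A nonzero element of U is y v with y in \<open>E\<close>, and its inverse is
    \<open>inv y \<otimes> w\<close> because \<open>E\<close> is a field.\<close>
  have invU: "inverses U \<subseteq> E #> w"
  proof
    fix s assume "s \<in> inverses U"
    then obtain t where t: "t \<in> U" "t \<noteq> \<zero>" "s = inv t"
      unfolding inverses_def by auto
    obtain c b where cb: "c \<in> K" "b \<in> K" "t = c \<otimes> u \<oplus> b \<otimes> v"
      using t memU by auto
    define y where "y = c \<otimes> x \<oplus> b"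
    have yE: "y \<in> E"
      unfolding y_def by (intro Ec(6,7) subsetD[OF KE] xE cb)
    then have yc: "y \<in> carrier L"
      using Ec(1) by auto
    have ty: "t = y \<otimes> v"
      unfolding y_def cb(3) using shift[of c b] cb sub by auto
    then have y0: "y \<noteq> \<zero>"
      using t(2) v' by auto
    have "s = inv y \<otimes> w"
      unfolding t(3) ty w_def using inv_mult[OF yc y0] v' by simp
    moreover have "inv y \<in> E"
      using subfield_m_inv(1)[OF E, of y] yE y0 by auto
    ultimately show "s \<in> E #> w"
      using memE by auto
  qed
  have Ew: "subalgebra K (E #> w) L"
    using r_coset_is_subalgebra[OF subfieldE(1)[OF E] KE w(1)] .
  have img: "E #> w = (\<lambda>e. e \<otimes> w) ` E"
    using memE by auto
  have SE: "Span K Fs \<subseteq> E #> w"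
    using subalgebra_Span_incl[OF K Ew] FsU invU by blast
  \<comment> \<open>Counting upgrades the inclusion of the span in \<open>E #> w\<close> to an
    equality: the span has q^n elements, the larger set at most q^n.\<close>
  have "card (Span K Fs) = q ^ n"
    using card_of_dimension[OF K finK dimension_independent[OF indF]] len assms(3) by simp
  moreover have "card (E #> w) \<le> q ^ n"
    unfolding img using card_image_le[OF cardE(1)] cardE(2) by metis
  ultimately have S: "Span K Fs = E #> w"
    using card_seteq[OF _ SE] cardE(1) img by simp
  have "E #> w \<subseteq> A"
    unfolding S[symmetric] using subalgebra_Span_incl[OF K assms(4)] FsU by blast
  then have "inverses U \<subseteq> A"
    using invU by blast
  moreover have "linear_span K (inverses U) = E #> w"
  proof
    show "linear_span K (inverses U) \<subseteq> E #> w"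
      unfolding linear_span_def using Ew invU by blast
    show "E #> w \<subseteq> linear_span K (inverses U)"
      \<comment> \<open>Every subspace containing U^-1 contains the vectors \<open>Fs\<close>, hence
        their span.\<close>
      unfolding linear_span_def S[symmetric] using subalgebra_Span_incl[OF K] FsU by blast
  qed
  ultimately show ?thesis
    using n0 E cardE(2) w(1,2) by blast
qed

end
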